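(* Let $X$ be a regular topological space and let $\mathscr{O}$ be the collection of all open covers of $X$. If $X$ satisfies $\mathbf{S}^*_{fin}(\mathscr{O},\mathscr{O})$, then $X$ satisfies $\mathbf{CS}_{fin}(\mathscr{O},\mathscr{O})$.
   Context: Regular spaces are understood as in Engelking's "General Topology" (so $T_1$ is included). For a set $Y$, $[Y]^{<\omega}$ is the collection of all finite subsets of $Y$ (including $\emptyset$; $\bigcup\emptyset=\emptyset$). For $A\subseteq X$ and a family $\mathcal{U}$ of subsets of $X$, the star of $A$ with respect to $\mathcal{U}$ is $St(A,\mathcal{U})=\bigcup\{U\in\mathcal{U}:U\cap A\neq\emptyset\}$. Let $\mathscr{A},\mathscr{B}$ be collections of families of subsets of $X$. $\mathbf{S}^*_{fin}(\mathscr{A},\mathscr{B})$: for any sequence $\{\mathcal{A}_n:n\in\omega\}$ of elements of $\mathscr{A}$ there is a sequence $\{\mathcal{B}_n:n\in\omega\}$ such that $\mathcal{B}_n$ is a finite subset of $\mathcal{A}_n$ for each $n\in\omega$, and $\bigcup_{n\in\omega}\{St(B,\mathcal{A}_n):B\in\mathcal{B}_n\}\in\mathscr{B}$. $\mathbf{CS}_{fin}(\mathscr{A},\mathscr{B})$: for any sequence $\{\mathcal{U}_n:n\in\omega\}$ of elements of $\mathscr{A}$ there is a sequence $\{\mathcal{U}_n^f:n\in\omega\}$ such that, for each $n\in\omega$, $\mathcal{U}_n^f=\{U_n^1,\dots,U_n^{k_n}\}$ is a finite subset of $\mathcal{U}_n$, and $\bigcup\{\mathcal{V}_n^i:n\in\omega\text{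 and }i\in\{1,\dots,k_n\}\}\in\mathscr{B}$, where $\mathcal{V}_n^i=\{\bigcup\mathcal{V}:\mathcal{V}\in[\mathcal{U}_n]^{<\omega}\text{ and }U_n^i\cap V\neq\emptyset\text{ for each }V\in\mathcal{V}\}$. *)

theory Defs
  imports "HOL-Analysis.Analysis"
begin

definition open_covers :: "'a topology \<Rightarrow> 'a set set set" where
  "open_covers X = {\<U>. (\<forall>U\<in>\<U>. openin X U) \<and> \<Union>\<U> = topspace X}"

definition St :: "'a set \<Rightarrow> 'a set set \<Rightarrow> 'a set" where
  "St A \<U> = \<Union>{U \<in> \<U>. U \<inter> A \<noteq> {}}"

definition S_star_fin :: "'a set set set \<Rightarrow> 'a set set set \<Rightarrow> bool" where
  "S_star_fin \<A> \<B> \<longleftrightarrow>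
     (\<forall>A :: nat \<Rightarrow> 'a set set. (\<forall>n. A n \<in> \<A>) \<longrightarrow>
       (\<exists>B :: nat \<Rightarrow> 'a set set.
          (\<forall>n. finite (B n) \<and> B n \<subseteq> A n) \<and>
          (\<Union>n. {St C (A n) | C. C \<in> B n}) \<in> \<B>))"

text \<open>The family \<open>finite_unions_meeting U \<U>\<close> is the $\mathcal{V}_n^i$ attached to
  $U = U_n^i$ and $\mathcal{U} = \mathcal{U}_n$ in the definition of $\mathbf{CS}_{fin}$.
  It always contains the empty set, as the union of the empty subfamily.\<close>

definition finite_unions_meeting :: "'a set \<Rightarrow> 'a set set \<Rightarrow> 'a set set" where
  "finite_unions_meeting U \<U> = {\<Union>\<V> | \<V>. finite \<V> \<and> \<V> \<subseteq> \<U> \<and> (\<forall>V\<in>\<V>. U \<inter> V \<noteq> {})}"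

text \<open>The enumeration $\{U_n^1,\dots,U_n^{k_n}\}$ of the $n$-th finite subfamily enters only
  as an index set, so the families are indexed by the members of \<open>F n\<close> themselves.\<close>

definition CS_fin :: "'a set set set \<Rightarrow> 'a set set set \<Rightarrow> bool" where
  "CS_fin \<A> \<B> \<longleftrightarrow>
     (\<forall>\<U> :: nat \<Rightarrow> 'a set set. (\<forall>n. \<U> n \<in> \<A>) \<longrightarrow>
       (\<exists>F :: nat \<Rightarrow> 'a set set.
          (\<forall>n. finite (F n) \<and> F n \<subseteq> \<U> n) \<and>
          (\<Union>n. \<Union>U\<in>F n. finite_unions_meeting U (\<U> n)) \<in> \<B>))"

end

theory Submission
  imports Defs
begin

text \<open>For a family \<open>\<U>\<close> and a set \<open>U\<close>, the finite unions of members of \<open>\<U>\<close> meeting \<open>U\<close>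
  together cover exactly the star of \<open>U\<close>: each single member of \<open>\<U>\<close> meeting \<open>U\<close> is such a
  union, and each such union lies inside the star. Hence the finite subfamilies that witness the
  star selection principle also witness the other one: replacing the single set \<open>St U \<U>\<close> by the
  finite unions changes neither the openness of the members nor the set that is covered.\<close>

lemma Union_finite_unions_meeting: "\<Union>(finite_unions_meeting U \<U>) = St U \<U>"
proof
  show "\<Union>(finite_unions_meeting U \<U>) \<subseteq> St U \<U>"
    unfolding finite_unions_meeting_def St_def by blast
  show "St U \<U> \<subseteq> \<Union>(finite_unions_meeting U \<U>)"
  proof
    fix x assume "x \<in> St U \<U>"
    then obtain V where V: "V \<in> \<U>" "U \<inter> V \<noteq> {}" "x \<in> V"
      by (auto simp: St_def)
    then have "\<Union>{V} \<in> finite_unions_meeting U \<U>"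
      unfolding finite_unions_meeting_def by blast
    with \<open>x \<in> V\<close> show "x \<in> \<Union>(finite_unions_meeting U \<U>)"
      by auto
  qed
qed

lemma openin_finite_unions_meeting:
  assumes "\<U> \<in> open_covers X" and "W \<in> finite_unions_meeting U \<U>"
  shows "openin X W"
  using assms unfolding open_covers_def finite_unions_meeting_def by (auto intro!: openin_Union)

lemma S_star_fin_imp_CS_fin:
  assumes "S_star_fin (open_covers X) (open_covers X)"
  shows "CS_fin (open_covers X) (open_covers X)"
  unfolding CS_fin_def
proof (intro allI impI)
  fix \<U> :: "nat \<Rightarrow> 'a set set"
  assume \<U>: "\<forall>n. \<U> n \<in> open_covers X"
  then obtain F where F: "\<forall>n. finite (F n) \<and> F n \<subseteq> \<U> n"
    and cover: "(\<Union>n. {St C (\<U> n) | C. C \<in> F n}) \<in> open_covers X"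
    using assms unfolding S_star_fin_def by blast
  let ?\<W> = "\<Union>n. \<Union>U\<in>F n. finite_unions_meeting U (\<U> n)"
  have "\<Union>?\<W> = (\<Union>n. \<Union>U\<in>F n. \<Union>(finite_unions_meeting U (\<U> n)))"
    by blast
  also have "\<dots> = \<Union>(\<Union>n. {St C (\<U> n) | C. C \<in> F n})"
    unfolding Union_finite_unions_meeting by blast
  also have "\<dots> = topspace X"
    using cover by (simp add: open_covers_def)
  finally have "\<Union>?\<W> = topspace X" .
  moreover have "\<forall>W\<in>?\<W>. openin X W"
    using \<U> openin_finite_unions_meeting by blast
  ultimately have "?\<W> \<in> open_covers X"
    by (simp add: open_covers_def)
  with F show "\<exists>F. (\<forall>n. finite (F n) \<and> F n \<subseteq> \<U> n) \<and>
      (\<Union>n. \<Union>U\<in>F n. finite_unions_meeting U (\<U> n)) \<in> open_covers X"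
    by blast
qed

theorem proposition2p10:
  fixes X :: "'a topology"
  assumes "regular_space X" and "t1_space X"
    and "S_star_fin (open_covers X) (open_covers X)"
  shows "CS_fin (open_covers X) (open_covers X)"
  using assms(3) by (rule S_star_fin_imp_CS_fin)

end
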